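(* Let $\Theta\subseteq\mathbb{R}^n$ be a set of finite Lebesgue measure and let $U:\Theta\to[0,1]$ be measurable. Let $\alpha\in(0,1]$, $\epsilon\in(0,1]$, $\delta>0$, $\sigma\in(0,1)$ and $J\ge1$ be such that $$J\ \ge\ \frac{1+\epsilon+\delta}{\epsilon}\left[\log\frac{\sigma}{1-\sigma}+\log\frac1\alpha+2\log\frac{1+\delta}{\delta}\right].$$ Let $\boldsymbol{\theta}_k$, with distribution $P_{\boldsymbol{\theta}_k}$, be the state (at step $k$) of the chain of an MCMC algorithm with target distribution $\pi(\,\cdot\,;J,\delta)$. Then $$P_{\boldsymbol{\theta}_k}(\Theta(\epsilon,\alpha))\ \ge\ \sigma-\|P_{\boldsymbol{\theta}_k}-\pi(\,\cdot\,;J,\delta)\|_{\mathrm{TV}}.$$ In other words, the statement "$\boldsymbol{\theta}_k$ is an approximate domain optimizer of $U$ with value imprecision $\epsilon$ and residual domain $\alpha$" can be made with confidence $\sigma-\|P_{\boldsymbol{\theta}_k}-\pi(\,\cdot\,;J,\delta)\|_{\mathrm{TV}}$.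
   Context: $\lambda$ denotes Lebesgue measure; it is assumed $\lambda(\Theta)>0$. $\log$ is the natural logarithm. $\pi(\,\cdot\,;J,\delta)$ is the probability measure on $\Theta$ whose density with respect to $\lambda$ is $[U(\theta)+\delta]^J/\int_\Theta[U(\theta')+\delta]^J\lambda(d\theta')$. For $\epsilon\ge0$ and $\alpha\in[0,1]$, the set of approximate domain optimizers of $U$ with value imprecision $\epsilon$ and residual domain $\alpha$ is $$\Theta(\epsilon,\alpha):=\{\theta\in\Theta : \lambda(\{\theta'\in\Theta : U(\theta')>U(\theta)+\epsilon\})\le\alpha\,\lambda(\Theta)\}.$$ An MCMC algorithm with target distribution $\pi(\,\cdot\,;J,\delta)$ simulates a Markov chain on $\Theta$ having $\pi(\,\cdot\,;J,\delta)$ as equilibrium (invariant) distribution. Total variation distance of probability measures on $\Theta$: $\|\mu_1-\mu_2\|_{\mathrm{TV}}=\sup_{A\in\mathfrak{B}(\Theta)}|\mu_1(A)-\mu_2(A)|$, with $\mathfrak{B}(\Theta)$ the Borel $\sigma$-algebra. *)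

theory Defs
  imports "HOL-Probability.Probability"
begin

text \<open>
  \<open>borel_on T\<close> is the Borel \<open>\<sigma>\<close>-algebra of a set \<open>T\<close>, i.e. the traces on \<open>T\<close> of the Borel sets
  (its measure component is not used).
\<close>

abbreviation borel_on :: "'a::topological_space set \<Rightarrow> 'a measure" where
  "borel_on T \<equiv> restrict_space borel T"

text \<open>
  Lebesgue measure on the Borel \<open>\<sigma>\<close>-algebra of \<open>T\<close>. The set \<open>T\<close> need only be Lebesgue measurable,
  hence the detour via \<open>lebesgue_on\<close>: for a non-Borel \<open>T\<close>, \<open>lborel\<close> would assign mass zero to
  sets that are Borel in \<open>T\<close> but not in the whole space.
\<close>

definition leb_borel_on :: "'a::euclidean_space set \<Rightarrow> 'a measure" where
  "leb_borel_on T = distr (lebesgue_on T) (borel_on T) (\<lambda>x. x)"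

text \<open>
  The exponent \<open>J\<close> is real; for integer \<open>J\<close> the real power agrees with the usual one because the
  base \<open>U \<theta> + \<delta>\<close> is positive.
\<close>

definition mcmc_target ::
  "'a::euclidean_space set \<Rightarrow> ('a \<Rightarrow> real) \<Rightarrow> real \<Rightarrow> real \<Rightarrow> 'a measure" where
  "mcmc_target T U J \<delta> =
     density (leb_borel_on T)
       (\<lambda>\<theta>. ennreal ((U \<theta> + \<delta>) powr J / (\<integral>\<theta>'. (U \<theta>' + \<delta>) powr J \<partial>leb_borel_on T)))"

definition approx_domain_optimizers ::
  "'a::euclidean_space set \<Rightarrow> ('a \<Rightarrow> real) \<Rightarrow> real \<Rightarrow> real \<Rightarrow> 'a set" where
  "approx_domain_optimizers T U \<epsilon> \<alpha> =
     {\<theta> \<in> T. measure lebesgue {\<theta>' \<in> T. U \<theta>' > U \<theta> + \<epsilon>} \<le> \<alpha> * measure lebesgue T}"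

definition tv_dist :: "'a measure \<Rightarrow> 'a measure \<Rightarrow> real" where
  "tv_dist \<mu> \<nu> = (SUP A \<in> sets \<mu>. \<bar>measure \<mu> A - measure \<nu> A\<bar>)"

text \<open>
  The \<open>\<sigma>\<close>-algebra on the sample space generated by \<open>X 0, \<dots>, X k\<close>.
\<close>

definition history :: "'w measure \<Rightarrow> 'a measure \<Rightarrow> (nat \<Rightarrow> 'w \<Rightarrow> 'a) \<Rightarrow> nat \<Rightarrow> 'w measure" where
  "history M S X k =
     vimage_algebra (space M) (\<lambda>\<omega>. \<lambda>i\<in>{..k}. X i \<omega>) (\<Pi>\<^sub>M i\<in>{..k}. S)"

text \<open>
  A time-homogeneous Markov chain \<open>X\<close> on the probability space \<open>M\<close>, with state space \<open>S\<close>,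
  transition kernel \<open>K\<close> and arbitrary initial distribution.
\<close>

definition markov_chain ::
  "'w measure \<Rightarrow> 'a measure \<Rightarrow> ('a \<Rightarrow> 'a measure) \<Rightarrow> (nat \<Rightarrow> 'w \<Rightarrow> 'a) \<Rightarrow> bool" where
  "markov_chain M S K X \<longleftrightarrow>
     prob_space M \<and> K \<in> S \<rightarrow>\<^sub>M prob_algebra S \<and> (\<forall>k. X k \<in> M \<rightarrow>\<^sub>M S) \<and>
     (\<forall>k. \<forall>A \<in> sets S. AE \<omega> in M.
        real_cond_exp M (history M S X k) (indicator (X (Suc k) -` A \<inter> space M)) \<omega>
          = measure (K (X k \<omega>)) A)"

definition invariant_distribution :: "('a \<Rightarrow> 'a measure) \<Rightarrow> 'a measure \<Rightarrow> bool" where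
  "invariant_distribution K \<mu> \<longleftrightarrow> prob_space \<mu> \<and> \<mu> \<bind> K = \<mu>"

definition mcmc_chain ::
  "'w measure \<Rightarrow> 'a::topological_space set \<Rightarrow> 'a measure \<Rightarrow> ('a \<Rightarrow> 'a measure) \<Rightarrow>
    (nat \<Rightarrow> 'w \<Rightarrow> 'a) \<Rightarrow> bool" where
  "mcmc_chain M T \<mu> K X \<longleftrightarrow> markov_chain M (borel_on T) K X \<and> invariant_distribution K \<mu>"

lemma sets_leb_borel_on [simp]: "sets (leb_borel_on T) = sets (borel_on T)"
  by (simp add: leb_borel_on_def)

lemma space_leb_borel_on [simp]: "space (leb_borel_on T) = T"
  by (simp add: leb_borel_on_def space_restrict_space)

lemma sets_mcmc_target [simp]: "sets (mcmc_target T U J \<delta>) = sets (borel_on T)"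
  by (simp add: mcmc_target_def)

lemma measurable_ident_lebesgue_on_borel_on:
  "(\<lambda>x. x) \<in> lebesgue_on T \<rightarrow>\<^sub>M borel_on T"
  by (intro measurable_restrict_space3 measurable_completion measurable_ident_sets) auto

lemma emeasure_leb_borel_on:
  assumes "T \<in> sets lebesgue" "A \<in> sets (borel_on T)"
  shows "emeasure (leb_borel_on T) A = emeasure lebesgue A"
proof -
  have "A \<subseteq> T"
    using sets.sets_into_space[OF assms(2)] by (simp add: space_restrict_space)
  then have "(\<lambda>x. x) -` A \<inter> T = A" by auto
  then show ?thesis
    using assms \<open>A \<subseteq> T\<close> measurable_ident_lebesgue_on_borel_on[of T]
    by (simp add: leb_borel_on_def emeasure_distr emeasure_restrict_space space_restrict_space)
qed

lemma prob_space_mcmc_target: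
  assumes T: "T \<in> lmeasurable" and pos: "0 < measure lebesgue T"
    and U: "U \<in> borel_measurable (borel_on T)" "\<And>\<theta>. \<theta> \<in> T \<Longrightarrow> U \<theta> \<in> {0..1}"
    and "0 < \<delta>" "0 \<le> J"
  shows "prob_space (mcmc_target T U J \<delta>)"
proof -
  let ?L = "leb_borel_on T" and ?f = "\<lambda>\<theta>. (U \<theta> + \<delta>) powr J"
  have top: "T \<in> sets (borel_on T)"
    by (metis sets.top space_restrict_space2 space_leb_borel_on sets_leb_borel_on)
  have emT: "emeasure ?L (space ?L) = emeasure lebesgue T"
    using emeasure_leb_borel_on[OF _ top] T by (simp add: fmeasurableD)
  interpret L: finite_measure ?L
    using emT fmeasurableD2[OF T] by (intro finite_measureI) (simp only: infinity_ennreal_def not_False_eq_True)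
  have mU: "U \<in> borel_measurable ?L"
    using U(1) by (simp cong: measurable_cong_sets)
  have mf: "?f \<in> borel_measurable ?L"
    using mU by measurable
  have bd: "\<delta> powr J \<le> ?f \<theta> \<and> ?f \<theta> \<le> (1 + \<delta>) powr J" if "\<theta> \<in> T" for \<theta>
    using U(2)[OF that] assms(5,6) by (auto intro!: powr_mono2)
  have int: "integrable ?L ?f"
    by (rule L.integrable_const_bound[where B = "(1 + \<delta>) powr J"])
       (use bd mf in \<open>auto intro!: AE_I2\<close>)
  have "measure ?L (space ?L) = measure lebesgue T"
    using emT by (simp add: measure_def)
  then have "(\<integral>\<theta>. \<delta> powr J \<partial>?L) = \<delta> powr J * measure lebesgue T" by simp
  moreover have "(\<integral>\<theta>. \<delta> powr J \<partial>?L) \<le> (\<integral>\<theta>. ?f \<theta> \<partial>?L)"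
    by (rule integral_mono) (use int bd in auto)
  moreover have "0 < \<delta> powr J * measure lebesgue T" using pos assms(5) by simp
  ultimately have c: "0 < (\<integral>\<theta>. ?f \<theta> \<partial>?L)" by linarith
  have "(\<integral>\<^sup>+\<theta>. ennreal (?f \<theta> / (\<integral>\<theta>. ?f \<theta> \<partial>?L)) \<partial>?L)
      = ennreal (\<integral>\<theta>. ?f \<theta> / (\<integral>\<theta>. ?f \<theta> \<partial>?L) \<partial>?L)"
    by (rule nn_integral_eq_integral) (use int c in auto)
  also have "\<dots> = 1" using c by simp
  finally have i: "(\<integral>\<^sup>+\<theta>. ennreal (?f \<theta> / (\<integral>\<theta>. ?f \<theta> \<partial>?L)) \<partial>?L) = 1" .
  have "emeasure (mcmc_target T U J \<delta>) (space ?L)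
      = (\<integral>\<^sup>+\<theta>. ennreal (?f \<theta> / (\<integral>\<theta>. ?f \<theta> \<partial>?L)) * indicator (space ?L) \<theta> \<partial>?L)"
    unfolding mcmc_target_def using mf top by (intro emeasure_density) simp_all
  also have "\<dots> = (\<integral>\<^sup>+\<theta>. ennreal (?f \<theta> / (\<integral>\<theta>. ?f \<theta> \<partial>?L)) \<partial>?L)"
    by (intro nn_integral_cong) simp
  finally have "emeasure (mcmc_target T U J \<delta>) (space ?L) = 1" using i by simp
  then show ?thesis
    by (intro prob_spaceI) (simp add: mcmc_target_def)
qed

end

theory Submission
  imports Defs
begin

text \<open>
  Since \<open>tv_dist\<close> bounds the difference of two laws on every event
  (\<open>measure_diff_le_tv_dist\<close>), it suffices that the target distribution gives
  \<open>\<Theta>(\<epsilon>, \<alpha>)\<close> mass at least \<open>\<sigma>\<close> (\<open>mcmc_target_approx_domain_optimizers\<close>).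

  Let \<open>N\<close> be the set of points that are not approximate optimizers, assumed nonempty, and
  \<open>s\<close> the supremum of \<open>U\<close> on \<open>N\<close>. A point of \<open>N\<close> at which \<open>U\<close> is close to \<open>s\<close> comes with a set \<open>B\<close> of more than the fraction
  \<open>\<alpha>\<close> of the volume, on which \<open>U\<close> exceeds \<open>s + x\<close>; here \<open>x\<close> may be any positive number below \<open>\<epsilon>\<close>. So \<open>B\<close> is
  disjoint from \<open>N\<close>, and comparing the unnormalised density \<open>(U + \<delta>) powr J\<close> on the two sets bounds
  the odds of \<open>N\<close> against \<open>B\<close> by \<open>((s + \<delta>) / (s + x + \<delta>)) powr J / \<alpha>\<close>
  (\<open>prob_le_if_density_dominated\<close>). As \<open>U\<close> never exceeds 1,
  \<open>s + x < 1\<close>, and the base of this power is at most \<open>1 - x / (1 + \<delta>) \<le> exp (- x / (1 + \<delta>))\<close>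
  (\<open>powr_gap\<close>).

  The choice \<open>x / (1 + \<delta>) = \<epsilon> / (1 + \<epsilon> + \<delta>)\<close> leaves \<open>x\<close> strictly below \<open>\<epsilon>\<close>, which is why the
  supremum \<open>s\<close> need not be attained, and it matches the factor in the lower bound on \<open>J\<close>:
  the odds become at most \<open>(1 - \<sigma>) / \<sigma>\<close> (\<open>exp_le_odds\<close>), so \<open>N\<close> has mass at most \<open>1 - \<sigma>\<close>.
\<close>

lemma measure_leb_borel_on:
  assumes "T \<in> sets lebesgue" "A \<in> sets (borel_on T)"
  shows "measure (leb_borel_on T) A = measure lebesgue A"
  using emeasure_leb_borel_on[OF assms] by (simp add: measure_def)

lemma finite_measure_leb_borel_on:
  fixes T :: "'a::euclidean_space set"
  assumes "T \<in> lmeasurable"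
  shows "finite_measure (leb_borel_on T)"
proof (rule finite_measureI)
  have "T \<in> sets (borel_on T)"
    by (metis sets.top space_leb_borel_on sets_leb_borel_on)
  then have "emeasure (leb_borel_on T) T = emeasure lebesgue T"
    using assms by (intro emeasure_leb_borel_on) (auto dest: fmeasurableD)
  then show "emeasure (leb_borel_on T) (space (leb_borel_on T)) \<noteq> \<infinity>"
    using fmeasurableD2[OF assms] by simp
qed

lemma superlevel_set_in_borel_on:
  assumes "U \<in> borel_measurable (borel_on T)"
  shows "{\<theta> \<in> T. U \<theta> > (u::real)} \<in> sets (borel_on T)"
proof -
  have "{\<theta> \<in> space (borel_on T). u < U \<theta>} \<in> sets (borel_on T)"
    using assms by measurable
  then show ?thesis by (simp add: space_restrict_space)
qed

text \<open>
  Membership of \<open>\<theta>\<close> depends on \<open>U \<theta>\<close> alone, through the volume of a superlevel set. That volume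
  is monotone in the level, hence a Borel function of it.
\<close>

lemma approx_domain_optimizers_in_borel_on:
  fixes T :: "'a::euclidean_space set"
  assumes T: "T \<in> lmeasurable" and U: "U \<in> borel_measurable (borel_on T)"
  shows "approx_domain_optimizers T U \<epsilon> \<alpha> \<in> sets (borel_on T)"
proof -
  interpret L: finite_measure "leb_borel_on T"
    using T by (rule finite_measure_leb_borel_on)
  define g where "g u = measure (leb_borel_on T) {\<theta>' \<in> T. U \<theta>' > u}" for u
  have g: "g u = measure lebesgue {\<theta>' \<in> T. U \<theta>' > u}" for u
    unfolding g_def using T superlevel_set_in_borel_on[OF U]
    by (intro measure_leb_borel_on) (auto dest: fmeasurableD)
  have "mono (\<lambda>u. - g u)"
    unfolding g_def using superlevel_set_in_borel_on[OF U]
    by (intro monoI le_imp_neg_le L.finite_measure_mono) auto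
  then have [measurable]: "g \<in> borel_measurable borel"
    using borel_measurable_mono[of "\<lambda>u. - g u"] borel_measurable_uminus_eq[of g borel] by simp
  have "{\<theta> \<in> space (borel_on T). g (U \<theta> + \<epsilon>) \<le> \<alpha> * measure lebesgue T} \<in> sets (borel_on T)"
    using U by measurable
  then show ?thesis
    by (simp add: approx_domain_optimizers_def g space_restrict_space)
qed

lemma measure_density_le_mult:
  fixes h :: "'a \<Rightarrow> real"
  assumes "finite_measure L" "h \<in> borel_measurable L" "A \<in> sets L" "0 \<le> b"
    and "\<And>x. x \<in> A \<Longrightarrow> h x \<le> b"
  shows "measure (density L h) A \<le> b * measure L A"
proof -
  interpret finite_measure L by fact
  have "emeasure (density L h) A = (\<integral>\<^sup>+x. ennreal (h x) * indicator A x \<partial>L)"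
    using assms by (intro emeasure_density) auto
  also have "\<dots> \<le> (\<integral>\<^sup>+x. ennreal b * indicator A x \<partial>L)"
    using assms by (intro nn_integral_mono) (auto split: split_indicator intro: ennreal_leI)
  also have "\<dots> = ennreal (b * measure L A)"
    using assms by (simp add: nn_integral_cmult_indicator emeasure_eq_measure ennreal_mult)
  finally show ?thesis
    using assms(4) by (simp add: measure_def enn2real_leI)
qed

lemma mult_le_measure_density:
  fixes h :: "'a \<Rightarrow> real"
  assumes "finite_measure L" "finite_measure (density L h)"
    and "h \<in> borel_measurable L" "A \<in> sets L" "0 \<le> c"
    and "\<And>x. x \<in> A \<Longrightarrow> c \<le> h x"
  shows "c * measure L A \<le> measure (density L h) A"
proof -
  interpret finite_measure L by fact
  interpret D: finite_measure "density L h" by fact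
  have "ennreal (c * measure L A) = (\<integral>\<^sup>+x. ennreal c * indicator A x \<partial>L)"
    using assms by (simp add: nn_integral_cmult_indicator emeasure_eq_measure ennreal_mult)
  also have "\<dots> \<le> (\<integral>\<^sup>+x. ennreal (h x) * indicator A x \<partial>L)"
    using assms by (intro nn_integral_mono) (auto split: split_indicator intro: ennreal_leI)
  also have "\<dots> = ennreal (measure (density L h) A)"
    using assms by (subst emeasure_density[symmetric]) (auto simp: D.emeasure_eq_measure)
  finally show ?thesis by simp
qed

text \<open>
  Where \<open>B\<close> fills a fraction \<open>\<alpha>\<close> of the space, the bounds on the density give odds of \<open>N\<close> against
  \<open>B\<close> of at most \<open>b / (\<alpha> c)\<close>. Odds of at most \<open>(1 - \<sigma>) / \<sigma>\<close> against a disjoint set leave \<open>N\<close>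
  a probability of at most \<open>1 - \<sigma>\<close>.
\<close>

lemma prob_le_if_density_dominated:
  fixes h :: "'a \<Rightarrow> real"
  assumes L: "finite_measure L" and P: "prob_space (density L h)"
    and h: "h \<in> borel_measurable L"
    and N: "N \<in> sets L" and B: "B \<in> sets L" and disj: "N \<inter> B = {}"
    and hN: "\<And>x. x \<in> N \<Longrightarrow> h x \<le> b" and hB: "\<And>x. x \<in> B \<Longrightarrow> c \<le> h x"
    and b: "0 \<le> b" and c: "0 \<le> c"
    and frac: "\<alpha> * measure L (space L) \<le> measure L B"
    and odds: "b * \<sigma> \<le> c * \<alpha> * (1 - \<sigma>)" and \<sigma>: "0 < \<sigma>" "\<sigma> < 1"
  shows "measure (density L h) N \<le> 1 - \<sigma>"
proof -
  interpret L: finite_measure L by fact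
  interpret P: prob_space "density L h" by fact
  let ?P = "measure (density L h)" and ?m = "measure L (space L)"
  have "?P N \<le> b * measure L N"
    using L h N b hN by (rule measure_density_le_mult)
  also have "\<dots> \<le> b * ?m"
    using b by (intro mult_left_mono L.bounded_measure)
  finally have "\<sigma> * ?P N \<le> (b * \<sigma>) * ?m"
    using \<sigma> mult_left_mono[of "?P N" "b * ?m" \<sigma>] by (simp add: mult_ac)
  also have "\<dots> \<le> (c * \<alpha> * (1 - \<sigma>)) * ?m"
    using odds by (intro mult_right_mono) auto
  also have "\<dots> = (1 - \<sigma>) * (c * (\<alpha> * ?m))" by (simp add: mult_ac)
  also have "\<dots> \<le> (1 - \<sigma>) * (c * measure L B)"
    using frac c \<sigma> by (intro mult_left_mono) auto
  also have "\<dots> \<le> (1 - \<sigma>) * ?P B"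
    using \<sigma> mult_le_measure_density[OF L P.finite_measure_axioms h B c hB]
    by (intro mult_left_mono) auto
  also have "\<dots> \<le> (1 - \<sigma>) * (1 - ?P N)"
  proof -
    have "?P N + ?P B = ?P (N \<union> B)"
      using N B disj by (subst P.finite_measure_Union) auto
    also have "\<dots> \<le> 1" by simp
    finally show ?thesis using \<sigma> by (intro mult_left_mono) auto
  qed
  finally show ?thesis by (simp add: algebra_simps)
qed

text \<open>
  With \<open>x = (1 + \<delta>) * y\<close>, the ratio \<open>(u + \<delta>) / (u + x + \<delta>) = 1 - x / (u + x + \<delta>)\<close> is largest
  when \<open>u + x\<close> reaches its maximal value 1, where it equals \<open>1 - y \<le> exp (- y)\<close>.
\<close>

lemma powr_gap:
  fixes u \<delta> y J :: real
  assumes "0 < \<delta>" "0 \<le> u" "0 \<le> y" "u + (1 + \<delta>) * y \<le> 1" "0 \<le> J"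
  shows "(u + \<delta>) powr J \<le> exp (- (y * J)) * (u + (1 + \<delta>) * y + \<delta>) powr J"
proof -
  let ?v = "u + (1 + \<delta>) * y + \<delta>"
  have v: "0 < ?v" using assms by (simp add: add_nonneg_pos)
  have "y * ?v \<le> y * (1 + \<delta>)"
    using assms by (intro mult_left_mono) auto
  then have "u + \<delta> \<le> (1 - y) * ?v" by (simp add: algebra_simps)
  also have "\<dots> \<le> exp (- y) * ?v"
    using v exp_ge_add_one_self[of "- y"] by (intro mult_right_mono) auto
  finally have "(u + \<delta>) powr J \<le> (exp (- y) * ?v) powr J"
    using assms by (intro powr_mono2) auto
  also have "\<dots> = exp (- y) powr J * ?v powr J"
    using v by (simp add: powr_mult)
  also have "exp (- y) powr J = exp (- (y * J))"
    by (simp add: powr_def mult_ac)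
  finally show ?thesis .
qed

text \<open>
  The bracket in the bound on \<open>J\<close> is at least \<open>ln (\<sigma> / (1 - \<sigma>)) + ln (1 / \<alpha>)\<close>, which is
  \<open>- ln (\<alpha> * (1 - \<sigma>) / \<sigma>)\<close>, and the factor \<open>\<epsilon> / (1 + \<epsilon> + \<delta>)\<close> is the inverse of the one before it.
\<close>

lemma exp_le_odds:
  fixes \<alpha> \<epsilon> \<delta> \<sigma> J :: real
  assumes "0 < \<alpha>" "0 < \<epsilon>" "0 < \<delta>" "0 < \<sigma>" "\<sigma> < 1"
    and J: "J \<ge> (1 + \<epsilon> + \<delta>) / \<epsilon> * (ln (\<sigma> / (1 - \<sigma>)) + ln (1 / \<alpha>) + 2 * ln ((1 + \<delta>) / \<delta>))"
  shows "exp (- (\<epsilon> / (1 + \<epsilon> + \<delta>) * J)) * \<sigma> \<le> \<alpha> * (1 - \<sigma>)"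
proof -
  let ?L = "ln (\<sigma> / (1 - \<sigma>)) + ln (1 / \<alpha>)"
  let ?y = "\<epsilon> / (1 + \<epsilon> + \<delta>)" and ?S = "?L + 2 * ln ((1 + \<delta>) / \<delta>)"
  have "0 \<le> ln ((1 + \<delta>) / \<delta>)" using assms by (intro ln_ge_zero) (simp add: field_simps)
  then have "?L \<le> ?S" by simp
  also have "?S = ?y * ((1 + \<epsilon> + \<delta>) / \<epsilon> * ?S)"
    using assms by simp
  also have "\<dots> \<le> ?y * J"
    using J assms by (intro mult_left_mono) auto
  finally have "exp (- (?y * J)) \<le> exp (- ?L)" by simp
  also have "exp (- ?L) = \<alpha> * (1 - \<sigma>) / \<sigma>"
    using assms by (simp add: exp_diff exp_minus ln_div exp_add field_simps)
  finally show ?thesis using assms by (simp add: field_simps)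
qed

lemma mcmc_target_approx_domain_optimizers:
  fixes T :: "'a::euclidean_space set" and U :: "'a \<Rightarrow> real"
  assumes T: "T \<in> lmeasurable" and pos: "0 < measure lebesgue T"
    and U: "U \<in> borel_measurable (borel_on T)" and U01: "\<And>\<theta>. \<theta> \<in> T \<Longrightarrow> U \<theta> \<in> {0..1}"
    and \<alpha>: "0 < \<alpha>" and \<epsilon>: "0 < \<epsilon>" and \<delta>: "0 < \<delta>" and \<sigma>: "0 < \<sigma>" "\<sigma> < 1" and J0: "0 \<le> J"
    and J: "J \<ge> (1 + \<epsilon> + \<delta>) / \<epsilon> * (ln (\<sigma> / (1 - \<sigma>)) + ln (1 / \<alpha>) + 2 * ln ((1 + \<delta>) / \<delta>))"
  shows "\<sigma> \<le> measure (mcmc_target T U J \<delta>) (approx_domain_optimizers T U \<epsilon> \<alpha>)"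
proof -
  let ?L = "leb_borel_on T" and ?P = "mcmc_target T U J \<delta>"
  let ?G = "approx_domain_optimizers T U \<epsilon> \<alpha>"
  define Z where "Z = (\<integral>\<theta>. (U \<theta> + \<delta>) powr J \<partial>?L)"
  define h where "h \<theta> = (U \<theta> + \<delta>) powr J / Z" for \<theta>
  define N where "N = T - ?G"
  interpret P: prob_space ?P
    using T pos U U01 \<delta> J0 by (rule prob_space_mcmc_target)
  have P_eq: "?P = density ?L h"
    by (simp add: mcmc_target_def h_def Z_def)
  have Z: "0 \<le> Z" unfolding Z_def by simp
  have spP: "space ?P = T" by (simp add: mcmc_target_def)
  have G: "?G \<in> sets (borel_on T)"
    using T U by (rule approx_domain_optimizers_in_borel_on)
  have N: "N \<in> sets (borel_on T)"
    unfolding N_def using G by (metis sets.compl_sets space_leb_borel_on sets_leb_borel_on)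
  have meas: "measure ?L A = measure lebesgue A" if "A \<in> sets (borel_on T)" for A
    using T that by (intro measure_leb_borel_on) (auto dest: fmeasurableD)
  have "measure ?P N \<le> 1 - \<sigma>"
  proof (cases "N = {}")
    case True
    then show ?thesis using \<sigma> by simp
  next
    case False
    define s where "s = (SUP \<theta>\<in>N. U \<theta>)"
    define y where "y = \<epsilon> / (1 + \<epsilon> + \<delta>)"
    define x where "x = (1 + \<delta>) * y"
    have NT: "N \<subseteq> T" by (auto simp: N_def)
    have bdd: "bdd_above (U ` N)"
      using U01 NT by (intro bdd_aboveI[of _ 1]) auto
    have Us: "U \<theta> \<le> s" if "\<theta> \<in> N" for \<theta>
      unfolding s_def using that bdd by (rule cSUP_upper)
    have y: "0 < y" using \<epsilon> \<delta> by (simp add: y_def)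
    have "\<epsilon> - x = \<epsilon> * y"
      using \<epsilon> \<delta> by (simp add: x_def y_def field_simps)
    moreover have "0 < \<epsilon> * y" using y \<epsilon> by simp
    ultimately have "x < \<epsilon>" by linarith
    moreover have "0 < x" using y \<delta> by (simp add: x_def)
    ultimately have x: "0 < x" "x < \<epsilon>" by simp_all
    \<comment> \<open>The gap between \<open>x\<close> and \<open>\<epsilon>\<close> makes up for the distance from \<open>U \<theta>\<close> to the supremum.\<close>
    have "s - (\<epsilon> - x) < s" using x by simp
    then obtain \<theta> where \<theta>: "\<theta> \<in> N" "s - (\<epsilon> - x) < U \<theta>"
      using less_cSUP_iff[OF False bdd] unfolding s_def by blast
    define B where "B = {\<theta>' \<in> T. U \<theta>' > U \<theta> + \<epsilon>}"
    have B: "B \<in> sets (borel_on T)"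
      unfolding B_def using U by (rule superlevel_set_in_borel_on)
    have big: "\<alpha> * measure lebesgue T < measure lebesgue B"
      using \<theta>(1) by (auto simp: N_def B_def approx_domain_optimizers_def not_le)
    have UB: "s + x \<le> U \<theta>'" if "\<theta>' \<in> B" for \<theta>'
      using that \<theta>(2) by (auto simp: B_def)
    have "B \<noteq> {}"
    proof
      assume "B = {}"
      then show False using big mult_pos_pos[OF \<alpha> pos] by simp
    qed
    then obtain \<theta>' where \<theta>': "\<theta>' \<in> B" by blast
    then have sx: "s + x \<le> 1"
      using UB[OF \<theta>'] U01[of \<theta>'] by (auto simp: B_def)
    have s0: "0 \<le> s"
      using Us[OF \<theta>(1)] U01[of \<theta>] \<theta>(1) NT by fastforce
    have "measure (density ?L h) N \<le> 1 - \<sigma>"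
    proof (rule prob_le_if_density_dominated[where B = B and \<alpha> = \<alpha>
          and b = "(s + \<delta>) powr J / Z" and c = "(s + x + \<delta>) powr J / Z"])
      show "finite_measure ?L" using T by (rule finite_measure_leb_borel_on)
      show "prob_space (density ?L h)" using P.prob_space_axioms by (simp add: P_eq)
      have [measurable]: "U \<in> borel_measurable ?L"
        using U by (simp cong: measurable_cong_sets)
      show "h \<in> borel_measurable ?L" unfolding h_def by measurable
      show "N \<in> sets ?L" "B \<in> sets ?L" using N B by simp_all
      show "N \<inter> B = {}" using Us UB x by fastforce
      show "h \<theta> \<le> (s + \<delta>) powr J / Z" if "\<theta> \<in> N" for \<theta>
      proof -
        have "0 \<le> U \<theta>" using U01[of \<theta>] that NT by auto
        then show ?thesis
          unfolding h_def using Us[OF that] Z J0 \<delta> by (intro divide_right_mono powr_mono2) auto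
      qed
      show "(s + x + \<delta>) powr J / Z \<le> h \<theta>" if "\<theta> \<in> B" for \<theta>
        unfolding h_def using UB[OF that] Z J0 \<delta> s0 x by (intro divide_right_mono powr_mono2) auto
      show "\<alpha> * measure ?L (space ?L) \<le> measure ?L B"
        using big meas[OF B] meas[of T] sets.top[of ?L] by simp
      have "(s + \<delta>) powr J * \<sigma> \<le> exp (- (y * J)) * (s + x + \<delta>) powr J * \<sigma>"
        unfolding x_def using \<delta> s0 y sx[unfolded x_def] J0 \<sigma>
        by (intro mult_right_mono powr_gap) auto
      also have "\<dots> = (s + x + \<delta>) powr J * (exp (- (y * J)) * \<sigma>)" by simp
      also have "\<dots> \<le> (s + x + \<delta>) powr J * (\<alpha> * (1 - \<sigma>))"
        unfolding y_def using exp_le_odds[OF \<alpha> \<epsilon> \<delta> \<sigma> J] by (intro mult_left_mono) auto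
      finally have "(s + \<delta>) powr J * \<sigma> / Z \<le> (s + x + \<delta>) powr J * (\<alpha> * (1 - \<sigma>)) / Z"
        using Z by (rule divide_right_mono)
      then show "(s + \<delta>) powr J / Z * \<sigma> \<le> (s + x + \<delta>) powr J / Z * \<alpha> * (1 - \<sigma>)"
        by (simp add: mult.assoc)
    qed (use Z \<sigma> in auto)
    then show ?thesis by (simp add: P_eq)
  qed
  moreover have "measure ?P N = 1 - measure ?P ?G"
    unfolding N_def using P.prob_compl[of ?G] G by (simp add: spP)
  ultimately show ?thesis by simp
qed

lemma measure_diff_le_tv_dist:
  assumes "prob_space \<mu>" "prob_space \<nu>" "A \<in> sets \<mu>"
  shows "\<bar>measure \<mu> A - measure \<nu> A\<bar> \<le> tv_dist \<mu> \<nu>"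
  unfolding tv_dist_def
proof (rule cSUP_upper[OF assms(3)], rule bdd_aboveI[of _ 1], clarify)
  fix C
  have "measure \<mu> C \<le> 1" "measure \<nu> C \<le> 1"
    using assms by (auto intro: prob_space.prob_le_1)
  then show "\<bar>measure \<mu> C - measure \<nu> C\<bar> \<le> 1"
    using measure_nonneg[of \<mu> C] measure_nonneg[of \<nu> C] by linarith
qed

theorem proposition4:
  fixes \<Theta> :: "(real ^ 'n) set" and U :: "real ^ 'n \<Rightarrow> real"
    and \<alpha> \<epsilon> \<delta> \<sigma> J :: real
    and M :: "'w measure" and K :: "real ^ 'n \<Rightarrow> (real ^ 'n) measure"
    and X :: "nat \<Rightarrow> 'w \<Rightarrow> real ^ 'n" and k :: nat
  assumes "\<Theta> \<in> lmeasurable" and "0 < measure lebesgue \<Theta>"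
    and "U \<in> borel_measurable (borel_on \<Theta>)" and "\<And>\<theta>. \<theta> \<in> \<Theta> \<Longrightarrow> U \<theta> \<in> {0..1}"
    and "\<alpha> \<in> {0<..1}" and "\<epsilon> \<in> {0<..1}" and "\<delta> > 0" and "\<sigma> \<in> {0<..<1}" and "J \<ge> 1"
    and "J \<ge> (1 + \<epsilon> + \<delta>) / \<epsilon> * (ln (\<sigma> / (1 - \<sigma>)) + ln (1 / \<alpha>) + 2 * ln ((1 + \<delta>) / \<delta>))"
    and "mcmc_chain M \<Theta> (mcmc_target \<Theta> U J \<delta>) K X"
  shows "measure (distr M (borel_on \<Theta>) (X k)) (approx_domain_optimizers \<Theta> U \<epsilon> \<alpha>)
           \<ge> \<sigma> - tv_dist (distr M (borel_on \<Theta>) (X k)) (mcmc_target \<Theta> U J \<delta>)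
       \<and> measure M {\<omega> \<in> space M. X k \<omega> \<in> approx_domain_optimizers \<Theta> U \<epsilon> \<alpha>}
           \<ge> \<sigma> - tv_dist (distr M (borel_on \<Theta>) (X k)) (mcmc_target \<Theta> U J \<delta>)"
proof -
  let ?G = "approx_domain_optimizers \<Theta> U \<epsilon> \<alpha>"
  let ?D = "distr M (borel_on \<Theta>) (X k)" and ?P = "mcmc_target \<Theta> U J \<delta>"
  have M: "prob_space M" and X: "X k \<in> M \<rightarrow>\<^sub>M borel_on \<Theta>"
    using assms(11) by (auto simp: mcmc_chain_def markov_chain_def)
  have G: "?G \<in> sets (borel_on \<Theta>)"
    using assms(1,3) by (rule approx_domain_optimizers_in_borel_on)
  have "prob_space ?P"
    using assms by (intro prob_space_mcmc_target) auto
  then have "\<bar>measure ?D ?G - measure ?P ?G\<bar> \<le> tv_dist ?D ?P"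
    using prob_space.prob_space_distr[OF M X] G by (intro measure_diff_le_tv_dist) auto
  moreover have "\<sigma> \<le> measure ?P ?G"
    using assms by (intro mcmc_target_approx_domain_optimizers) auto
  ultimately have "measure ?D ?G \<ge> \<sigma> - tv_dist ?D ?P" by linarith
  moreover have "measure ?D ?G = measure M {\<omega> \<in> space M. X k \<omega> \<in> ?G}"
    using X G by (simp add: measure_distr vimage_def Int_def conj_commute)
  ultimately show ?thesis by simp
qed

end
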